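(* Let $(Q,+)$ be a group, $\overline{\varphi},\overline{\psi}$ anti-automorphisms of $(Q,+)$, and $\alpha,\gamma\in S_Q$. The right alinear quasigroups $(Q,\cdot)$ and $(Q,\circ)$ given by $x\cdot y=\alpha x+\overline{\varphi}y$ and $x\circ y=\gamma x+\overline{\psi}y$ are orthogonal if and only if the mapping $(-(\overline{\varphi})^{-1}\alpha+(\overline{\psi})^{-1}\gamma)$, i.e. $x\mapsto-(\overline{\varphi})^{-1}\alpha x+(\overline{\psi})^{-1}\gamma x$, is a permutation of the set $Q$.
   Context: Groups are written additively but need not be commutative. $S_Q$ is the set of all permutations (bijections) of the set $Q$. Products of maps are compositions, $(\alpha\beta)x=\alpha(\beta x)$. An anti-automorphism of $(Q,+)$ is a permutation $\overline{\varphi}$ of $Q$ with $\overline{\varphi}(x+y)=\overline{\varphi}y+\overline{\varphi}x$ for all $x,y$. Two quasigroups $(Q,\cdot)$ and $(Q,\circ)$ on the same set are orthogonal if for all $a,b\in Q$ the system $x\cdot y=a$, $x\circ y=b$ has a unique solution $(x,y)\in Q\times Q$. A quasigroup of the form $x\cdot y=\alpha x+\overline{\varphi}y$ with $\alpha\in S_Q$ and $\overline\varphi$ an anti-automorphism is called right alinear. *)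

theory Defs
  imports Main
begin

text \<open>
  The underlying set \<open>Q\<close> is a type, so permutations of \<open>Q\<close> are the functions satisfying \<^const>\<open>bij\<close>.
  Groups are instances of \<^class>\<open>group_add\<close>, which is additive but not assumed commutative.
\<close>

definition anti_automorphism :: "('a::group_add \<Rightarrow> 'a) \<Rightarrow> bool" where
  "anti_automorphism \<phi> \<longleftrightarrow> bij \<phi> \<and> (\<forall>x y. \<phi> (x + y) = \<phi> y + \<phi> x)"

definition quasigroup :: "('a \<Rightarrow> 'a \<Rightarrow> 'a) \<Rightarrow> bool" where
  "quasigroup f \<longleftrightarrow> (\<forall>a b. (\<exists>!x. f x a = b) \<and> (\<exists>!y. f a y = b))"

definition orthogonal_quasigroups :: "('a \<Rightarrow> 'a \<Rightarrow> 'a) \<Rightarrow> ('a \<Rightarrow> 'a \<Rightarrow> 'a) \<Rightarrow> bool" where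
  "orthogonal_quasigroups f g \<longleftrightarrow> quasigroup f \<and> quasigroup g \<and>
     (\<forall>a b. \<exists>!(x, y). f x y = a \<and> g x y = b)"

end

theory Submission
  imports Defs
begin

text \<open>The inverse of an anti-automorphism again reverses sums, so each equation of the system
  can be solved for y in terms of x (\<open>right_alinear_eq_iff\<close>). Equating the two
  expressions for y eliminates it, and \<open>diff_eq_diff_iff_minus_add\<close> sorts the result
  into \<open>D x = - inv \<phi> a + inv \<psi> b\<close>, where \<open>D\<close> is the map in
  question. Hence the system for a, b is uniquely solvable exactly when this equation has a unique
  solution x. As a and b vary, the right-hand side takes every value in the group, so orthogonality
  says that \<open>D\<close> attains each value exactly once.\<close>

lemma anti_automorphism_inv_add:
  assumes "anti_automorphism \<phi>"
  shows "inv \<phi> (x + y) = inv \<phi> y + inv \<phi> x"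
proof -
  have bij: "bij \<phi>" and add: "\<And>x y. \<phi> (x + y) = \<phi> y + \<phi> x"
    using assms by (auto simp: anti_automorphism_def)
  have "\<phi> (inv \<phi> y + inv \<phi> x) = x + y"
    by (simp add: add surj_f_inv_f[OF bij_is_surj[OF bij]])
  then show ?thesis
    by (metis bij bij_inv_eq_iff)
qed

text \<open>Applying \<open>inv \<phi>\<close> reverses the sum and gives
  \<open>y + inv \<phi> u\<close>, so y is isolated by subtracting on the right.\<close>

lemma right_alinear_eq_iff:
  assumes "anti_automorphism \<phi>"
  shows "u + \<phi> y = a \<longleftrightarrow> y = inv \<phi> a - inv \<phi> u"
proof -
  have bij: "bij \<phi>"
    using assms by (simp add: anti_automorphism_def)
  have "u + \<phi> y = a \<longleftrightarrow> inv \<phi> (u + \<phi> y) = inv \<phi> a"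
    using bij_imp_bij_inv[OF bij] by (metis bij_is_inj injD)
  also have "\<dots> \<longleftrightarrow> y + inv \<phi> u = inv \<phi> a"
    by (simp add: anti_automorphism_inv_add[OF assms] inv_f_f[OF bij_is_inj[OF bij]])
  also have "\<dots> \<longleftrightarrow> y = inv \<phi> a - inv \<phi> u"
    by (auto simp: eq_diff_eq)
  finally show ?thesis .
qed

lemma quasigroup_right_alinear:
  assumes "anti_automorphism \<phi>" and "bij \<alpha>"
  shows "quasigroup (\<lambda>x y. \<alpha> x + \<phi> y)"
  unfolding quasigroup_def
proof (intro allI conjI)
  fix a b
  have "\<alpha> x + \<phi> a = b \<longleftrightarrow> x = inv \<alpha> (b - \<phi> a)" for x
    using bij_inv_eq_iff[OF assms(2), of x "b - \<phi> a"] eq_diff_eq[of "\<alpha> x" b "\<phi> a"] by blast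
  then show "\<exists>!x. \<alpha> x + \<phi> a = b"
    by simp
  show "\<exists>!y. \<alpha> a + \<phi> y = b"
    by (simp add: right_alinear_eq_iff[OF assms(1)])
qed

text \<open>Cancel \<open>a\<close> on the left and \<open>d\<close> on the right, keeping the order
  since addition need not commute. In the theorem, \<open>c\<close> and \<open>d\<close> carry the
  unknown x, while \<open>a\<close> and \<open>b\<close> come from the prescribed values; this
  separates them.\<close>

lemma diff_eq_diff_iff_minus_add:
  fixes a b c d :: "'a::group_add"
  shows "a - c = b - d \<longleftrightarrow> - c + d = - a + b"
proof -
  have "a - c = b - d \<longleftrightarrow> - a + (a - c) = - a + (b - d)"
    by simp
  also have "\<dots> \<longleftrightarrow> - c = - a + b - d"
    by (metis minus_add_cancel diff_conv_add_uminus add_diff_eq)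
  also have "\<dots> \<longleftrightarrow> - c + d = - a + b"
    by (rule eq_diff_eq)
  finally show ?thesis .
qed

theorem theorem28:
  fixes \<phi> \<psi> \<alpha> \<gamma> :: "'a::group_add \<Rightarrow> 'a"
    and dot circ :: "'a \<Rightarrow> 'a \<Rightarrow> 'a"
  assumes "anti_automorphism \<phi>" and "anti_automorphism \<psi>"
    and "bij \<alpha>" and "bij \<gamma>"
    and "\<And>x y. dot x y = \<alpha> x + \<phi> y"
    and "\<And>x y. circ x y = \<gamma> x + \<psi> y"
  shows "orthogonal_quasigroups dot circ \<longleftrightarrow>
    bij (\<lambda>x. - (inv \<phi> (\<alpha> x)) + inv \<psi> (\<gamma> x))"
proof -
  define D where "D x = - inv \<phi> (\<alpha> x) + inv \<psi> (\<gamma> x)" for x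
  have dot: "dot = (\<lambda>x y. \<alpha> x + \<phi> y)" and circ: "circ = (\<lambda>x y. \<gamma> x + \<psi> y)"
    using assms(5,6) by (simp_all add: fun_eq_iff)
  have quasigroups: "quasigroup dot" "quasigroup circ"
    unfolding dot circ using assms(1-4) by (simp_all add: quasigroup_right_alinear)
  have system: "dot x y = a \<and> circ x y = b \<longleftrightarrow>
      y = inv \<phi> a - inv \<phi> (\<alpha> x) \<and> D x = - inv \<phi> a + inv \<psi> b" for x y a b
  proof -
    have "D x = - inv \<phi> a + inv \<psi> b \<longleftrightarrow>
        inv \<phi> a - inv \<phi> (\<alpha> x) = inv \<psi> b - inv \<psi> (\<gamma> x)"
      unfolding D_def by (rule diff_eq_diff_iff_minus_add[symmetric])
    moreover have "dot x y = a \<longleftrightarrow> y = inv \<phi> a - inv \<phi> (\<alpha> x)"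
      unfolding dot by (rule right_alinear_eq_iff[OF assms(1)])
    moreover have "circ x y = b \<longleftrightarrow> y = inv \<psi> b - inv \<psi> (\<gamma> x)"
      unfolding circ by (rule right_alinear_eq_iff[OF assms(2)])
    ultimately show ?thesis
      by metis
  qed
  \<comment> \<open>By \<open>system\<close>, y is a function of x once a is fixed, so unique pairs
    correspond to unique first components.\<close>
  have solutions: "(\<exists>!(x, y). dot x y = a \<and> circ x y = b) \<longleftrightarrow>
      (\<exists>!x. D x = - inv \<phi> a + inv \<psi> b)" for a b
    unfolding system by (simp add: Ex1_def) blast
  have inv_zero: "inv \<phi> 0 = 0"
    using anti_automorphism_inv_add[OF assms(1), of 0 0] by (metis add.right_neutral add_left_cancel)
  have inv_psi_psi: "inv \<psi> (\<psi> c) = c" for c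
    using assms(2) by (simp add: anti_automorphism_def bij_is_inj inv_f_f)
  have "(\<forall>a b. \<exists>!x. D x = - inv \<phi> a + inv \<psi> b) \<longleftrightarrow> (\<forall>c. \<exists>!x. D x = c)"
  proof
    assume *: "\<forall>a b. \<exists>!x. D x = - inv \<phi> a + inv \<psi> b"
    show "\<forall>c. \<exists>!x. D x = c"
    proof
      fix c
      show "\<exists>!x. D x = c"
        \<comment> \<open>With a = 0 and b = \<open>\<psi> c\<close> the right-hand side
          \<open>- inv \<phi> a + inv \<psi> b\<close> collapses to \<open>c\<close>, so every
          target value is reached.\<close>
        using *[rule_format, of 0 "\<psi> c"] by (simp add: inv_zero inv_psi_psi)
    qed
  qed blast
  also have "\<dots> \<longleftrightarrow> bij D"
    by (metis bij_iff)
  finally show ?thesis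
    unfolding orthogonal_quasigroups_def solutions
    using quasigroups by (simp add: D_def[abs_def])
qed

end
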